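(* Let $\mathbf{z}_t = \begin{bmatrix} x_t \\ y_t \end{bmatrix} \in \mathbb{R}^2$ ($t\in\mathbb{Z}$) be a stable bivariate VAR($p$) process, $p\ge 1$, $$\mathbf{z}_t = A_1 \mathbf{z}_{t-1} + \cdots + A_p \mathbf{z}_{t-p} + \epsilon_t, \qquad \Sigma = \langle \epsilon_t\epsilon_t^\top\rangle = \begin{bmatrix} \Sigma_{xx} & \Sigma_{xy} \\ \Sigma_{xy} & \Sigma_{yy}\end{bmatrix},$$ with time-reversed representation $$\mathbf{z}_t = \tilde{A}_1 \mathbf{z}_{t+1} + \cdots + \tilde{A}_p \mathbf{z}_{t+p} + \tilde{\epsilon}_t, \qquad \tilde{\Sigma} = \langle \tilde{\epsilon}_t\tilde{\epsilon}_t^\top\rangle = \begin{bmatrix} \tilde{\Sigma}_{xx} & \tilde{\Sigma}_{xy} \\ \tilde{\Sigma}_{xy} & \tilde{\Sigma}_{yy}\end{bmatrix},$$ where the residual variances $\Sigma_{xx},\Sigma_{yy}$ are positive (so that the Granger scores are defined). Assume that (A1) $A_1,\ldots,A_p$ are lower triangular matrices; (A2) $\Sigma$ is a diagonal matrix, i.e. $\Sigma_{xy}=0$; (A3) $C_{\mathbf{z}}(0)$ is invertible. Then, with $\tilde{D}^{(net)}_{x\to y} = (F_{x\to y} - F_{y\to x}) - (\tilde{F}_{\tilde{x}\to\tilde{y}} - \tilde{F}_{\tilde{y}\to\tilde{x}})$, $$\tilde{D}^{(net)}_{x\to y} = 0 \iff A_1,\ldots,A_p \text{ are diagonal}.$$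
   Context: $\langle\cdot\rangle$ denotes expectation. For a stationary process $\mathbf{z}_t$ the cross-covariance matrices are $C_{\mathbf{z}}(h) = \big\langle (\mathbf{z}_t - \langle \mathbf{z}\rangle)(\mathbf{z}_{t-h} - \langle\mathbf{z}\rangle)^\top\big\rangle$, $h\in\mathbb{Z}$. Stable VAR($p$) process: $A_1,\ldots,A_p\in\mathbb{R}^{2\times 2}$ satisfy $\det(I - A_1\lambda - \cdots - A_p\lambda^p)\neq 0$ for all $\lambda\in\mathbb{C}$ with $|\lambda|\le 1$, and $\mathbf{z}_t$ is the (second-order) stationary process satisfying the recursion. The innovations (residuals) $\epsilon_t\in\mathbb{R}^2$ are white noise: they form a stationary process with finite covariance, $\langle\epsilon_t\rangle=0$, $\langle\epsilon_t\epsilon_{t-h}^\top\rangle=0$ for all $h\in\mathbb{Z}\setminus\{0\}$, and moreover $\langle\epsilon_t\mathbf{z}_{t-h}^\top\rangle=0$ for all integers $h\ge 1$. Neither independence nor Gaussianity of the $\epsilon_t$ is assumed. Time-reversed representation: the time-reversed process $\tilde{\mathbf{z}}_t := \mathbf{z}_{-t}$ has again a VAR($p$) representation (a known result of Andel), written as $\mathbf{z}_t = \tilde{A}_1 \mathbf{z}_{t+1} + \cdots + \tilde{A}_p \mathbf{z}_{t+p} + \tilde{\epsilon}_t$, where $\tilde{\epsilon}_t$ is white noise (mean zero, $\langle\tilde{\epsilon}_t\tilde{\epsilon}_{t-h}^\top\rangle=0$ for $h\in\mathbb{Z}\setminus\{0\}$) with $\langle\tilde{\epsilon}_t\mathbf{z}_{t+h}^\top\rangle=0$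 for all integers $h\ge 1$; its residual covariance matrix is $\tilde{\Sigma}=\langle\tilde{\epsilon}_t\tilde{\epsilon}_t^\top\rangle$. Restricted (univariate) models: $x_t$ and $y_t$ have autoregressive representations $x_t = \sum_{k=1}^\infty a_k x_{t-k} + \xi^x_t$ and $y_t = \sum_{k=1}^\infty b_k y_{t-k} + \xi^y_t$ with serially uncorrelated residuals of variances $\Sigma_x := \mathrm{Var}(\xi^x_t)$ and $\Sigma_y := \mathrm{Var}(\xi^y_t)$ (i.e. the variances of the error of the best linear prediction of $x_t$, resp. $y_t$, from its own past). Likewise, in reversed time, $x_t = \sum_{k=1}^\infty a_k x_{t+k} + \tilde{\xi}^x_t$ and $y_t = \sum_{k=1}^\infty b_k y_{t+k} + \tilde{\xi}^y_t$ with the same coefficients, and $\tilde{\Sigma}_x := \mathrm{Var}(\tilde{\xi}^x_t)$, $\tilde{\Sigma}_y := \mathrm{Var}(\tilde{\xi}^y_t)$ (the variances of the error of best linear prediction from the variable's own future); one has $\tilde{\Sigma}_x=\Sigma_x$ and $\tilde{\Sigma}_y=\Sigma_y$ because the autocovariance function of a univariate stationary series is symmetric. Granger scores: $F_{y\to x} := \log(\Sigma_x/\Sigma_{xx})$, $F_{x\to y} := \log(\Sigma_y/\Sigma_{yy})$. Time-reversed Granger scores: $\tilde{F}_{\tilde{y}\to\tilde{x}} := \log(\tilde{\Sigma}_x/\tilde{\Sigma}_{xx})$, $\tilde{F}_{\tilde{x}\to\tilde{y}} := \log(\tilde{\Sigma}_y/\tilde{\Sigma}_{yy})$. *)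

theory Defs
  imports "HOL-Probability.Probability"
begin

definition square_integrable :: "'w measure \<Rightarrow> ('w \<Rightarrow> real) \<Rightarrow> bool" where
  "square_integrable M X \<longleftrightarrow> X \<in> borel_measurable M \<and> integrable M (\<lambda>w. (X w)\<^sup>2)"

definition covar :: "'w measure \<Rightarrow> ('w \<Rightarrow> real) \<Rightarrow> ('w \<Rightarrow> real) \<Rightarrow> real" where
  "covar M X Y = (\<integral>w. (X w - (\<integral>v. X v \<partial>M)) * (Y w - (\<integral>v. Y v \<partial>M)) \<partial>M)"

definition cross_cov :: "'w measure \<Rightarrow> ('w \<Rightarrow> real^'n) \<Rightarrow> ('w \<Rightarrow> real^'n) \<Rightarrow> real^'n^'n" where
  "cross_cov M X Y = (\<chi> i j. covar M (\<lambda>w. X w $ i) (\<lambda>w. Y w $ j))"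

definition outer_moment :: "'w measure \<Rightarrow> ('w \<Rightarrow> real^'n) \<Rightarrow> ('w \<Rightarrow> real^'n) \<Rightarrow> real^'n^'n" where
  "outer_moment M X Y = (\<chi> i j. \<integral>w. X w $ i * Y w $ j \<partial>M)"

definition second_order_stationary :: "'w measure \<Rightarrow> (int \<Rightarrow> 'w \<Rightarrow> real^'n) \<Rightarrow> bool" where
  "second_order_stationary M z \<longleftrightarrow>
     (\<forall>t i. square_integrable M (\<lambda>w. z t w $ i)) \<and>
     (\<forall>s t i. (\<integral>w. z s w $ i \<partial>M) = (\<integral>w. z t w $ i \<partial>M)) \<and>
     (\<forall>s t h. cross_cov M (z s) (z (s - h)) = cross_cov M (z t) (z (t - h)))"

text \<open>
  The lag-\<open>h\<close> cross-covariance matrix of a stationary process. By stationarity the base time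
  is immaterial; it is taken to be 0 here and in \<open>residual_cov\<close> below.
\<close>

definition autocov :: "'w measure \<Rightarrow> (int \<Rightarrow> 'w \<Rightarrow> real^'n) \<Rightarrow> int \<Rightarrow> real^'n^'n" where
  "autocov M z h = cross_cov M (z 0) (z (- h))"

definition white_noise :: "'w measure \<Rightarrow> (int \<Rightarrow> 'w \<Rightarrow> real^'n) \<Rightarrow> bool" where
  "white_noise M e \<longleftrightarrow>
     second_order_stationary M e \<and>
     (\<forall>t i. (\<integral>w. e t w $ i \<partial>M) = 0) \<and>
     (\<forall>t h. h \<noteq> 0 \<longrightarrow> outer_moment M (e t) (e (t - h)) = 0)"

definition residual_cov :: "'w measure \<Rightarrow> (int \<Rightarrow> 'w \<Rightarrow> real^'n) \<Rightarrow> real^'n^'n" where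
  "residual_cov M e = outer_moment M (e 0) (e 0)"

definition time_reverse :: "(int \<Rightarrow> 'a) \<Rightarrow> int \<Rightarrow> 'a" where
  "time_reverse z t = z (- t)"

text \<open>Only the coefficients \<open>A 1, \<dots>, A p\<close> of the sequence \<open>A\<close> are used.\<close>

definition stable_coeffs :: "nat \<Rightarrow> (nat \<Rightarrow> real^'n^'n) \<Rightarrow> bool" where
  "stable_coeffs p A \<longleftrightarrow>
     (\<forall>l::complex. norm l \<le> 1 \<longrightarrow>
        det (mat 1 - (\<Sum>k=1..p. (\<chi> i j. complex_of_real (A k $ i $ j) * l ^ k))) \<noteq> 0)"

definition VAR_representation ::
    "'w measure \<Rightarrow> nat \<Rightarrow> (nat \<Rightarrow> real^'n^'n) \<Rightarrow> (int \<Rightarrow> 'w \<Rightarrow> real^'n) \<Rightarrow> (int \<Rightarrow> 'w \<Rightarrow> real^'n) \<Rightarrow> bool"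
  where
  "VAR_representation M p A z e \<longleftrightarrow>
     white_noise M e \<and>
     (\<forall>t. AE w in M. z t w = (\<Sum>k=1..p. A k *v z (t - int k) w) + e t w) \<and>
     (\<forall>t. \<forall>h\<ge>1. outer_moment M (e t) (z (t - h)) = 0)"

definition stable_VAR_process ::
    "'w measure \<Rightarrow> nat \<Rightarrow> (nat \<Rightarrow> real^'n^'n) \<Rightarrow> (int \<Rightarrow> 'w \<Rightarrow> real^'n) \<Rightarrow> (int \<Rightarrow> 'w \<Rightarrow> real^'n) \<Rightarrow> bool"
  where
  "stable_VAR_process M p A z e \<longleftrightarrow>
     stable_coeffs p A \<and> second_order_stationary M z \<and> VAR_representation M p A z e"

text \<open>
  The representation \<open>z t = \<Sum>k. At k *v z (t + k) + et t\<close> with \<open>et t\<close> uncorrelated with the future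
  \<open>z (t + h)\<close>, \<open>h \<ge> 1\<close>: after the substitution of \<open>- t\<close> for \<open>t\<close> it is a VAR representation of the
  reversed process, whose innovations are the reversed \<open>et\<close>.
\<close>

definition reversed_VAR_representation ::
    "'w measure \<Rightarrow> nat \<Rightarrow> (nat \<Rightarrow> real^'n^'n) \<Rightarrow> (int \<Rightarrow> 'w \<Rightarrow> real^'n) \<Rightarrow> (int \<Rightarrow> 'w \<Rightarrow> real^'n) \<Rightarrow> bool"
  where
  "reversed_VAR_representation M p At z et \<longleftrightarrow>
     VAR_representation M p At (time_reverse z) (time_reverse et)"

text \<open>
  \<open>x t = (\<Sum>k\<ge>1. a k * x (t - k)) + xi t\<close>, the series converging in mean square. The last clause
  makes \<open>xi t\<close> the error of the best linear prediction of \<open>x t\<close> from its own past; serial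
  uncorrelatedness alone would also admit non-causal representations, with a larger variance.
\<close>

definition AR_representation ::
    "'w measure \<Rightarrow> (nat \<Rightarrow> real) \<Rightarrow> (int \<Rightarrow> 'w \<Rightarrow> real) \<Rightarrow> (int \<Rightarrow> 'w \<Rightarrow> real) \<Rightarrow> bool"
  where
  "AR_representation M a x xi \<longleftrightarrow>
     (\<forall>t. square_integrable M (xi t)) \<and>
     (\<forall>t. (\<lambda>n. \<integral>w. (x t w - (\<Sum>k=1..n. a k * x (t - int k) w) - xi t w)\<^sup>2 \<partial>M) \<longlonglongrightarrow> 0) \<and>
     (\<forall>s t. s \<noteq> t \<longrightarrow> covar M (xi s) (xi t) = 0) \<and>
     (\<forall>t. \<forall>h\<ge>1. covar M (xi t) (x (t - h)) = 0)"

definition reversed_AR_representation ::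
    "'w measure \<Rightarrow> (nat \<Rightarrow> real) \<Rightarrow> (int \<Rightarrow> 'w \<Rightarrow> real) \<Rightarrow> (int \<Rightarrow> 'w \<Rightarrow> real) \<Rightarrow> bool"
  where
  "reversed_AR_representation M a x xit \<longleftrightarrow>
     AR_representation M a (time_reverse x) (time_reverse xit)"

definition residual_var :: "'w measure \<Rightarrow> (int \<Rightarrow> 'w \<Rightarrow> real) \<Rightarrow> real" where
  "residual_var M xi = prob_space.variance M (xi 0)"

text \<open>The first argument is the residual variance of the restricted model, the second one that of
  the full model.\<close>

definition granger_score :: "real \<Rightarrow> real \<Rightarrow> real" where
  "granger_score restricted full = ln (restricted / full)"

definition diagonal_matrix :: "real^2^2 \<Rightarrow> bool" where
  "diagonal_matrix B \<longleftrightarrow> B $ 1 $ 2 = 0 \<and> B $ 2 $ 1 = 0"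

text \<open>The built-in order of the index type \<open>2\<close> is not used, since there \<open>2 = 0 < 1\<close>.\<close>

definition lower_triangular_matrix :: "real^2^2 \<Rightarrow> bool" where
  "lower_triangular_matrix B \<longleftrightarrow> B $ 1 $ 2 = 0"

end

theory Submission
  imports "Jordan_Normal_Form.Determinant"
    "HOL-Computational_Algebra.Fundamental_Theorem_Algebra" Defs
begin

text \<open>
  Only second moments matter, so the argument takes place in the space of square-integrable
  variables with the covariance as a degenerate inner product.

  The restricted residual variances are the same in both directions of time
  (\<open>AR_residual_var_time_reverse\<close>), and they cancel in the net score. With \<open>S\<close> and \<open>St\<close> for the
  forward and the reversed innovation covariance, the score vanishes if and only if
  \<open>S $ 1 $ 1 * St $ 2 $ 2 = S $ 2 $ 2 * St $ 1 $ 1\<close>. Three facts decide when this happens.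

  First, \<open>S\<close> and \<open>St\<close> have the same determinant (\<open>det_residual_cov_time_reverse\<close>): the covariance
  determinant of \<open>z 0, \<dots>, z p\<close> is that of \<open>p\<close> consecutive variables multiplied by \<open>det S\<close>, and by
  time reversal also that of \<open>p\<close> consecutive variables multiplied by \<open>det St\<close>.

  Second, a component that is driven by its own past only can be predicted equally well from its own
  future, so that \<open>St $ i $ i \<le> S $ i $ i\<close> (\<open>reversed_innovation_variance_le\<close>). For lower triangular
  coefficients this applies to \<open>i = 1\<close>. For diagonal ones it applies to both components, and with
  \<open>S $ 1 $ 1 * S $ 2 $ 2 = det S = det St \<le> St $ 1 $ 1 * St $ 2 $ 2\<close> all diagonal entries must agree.
  Conversely, a vanishing score makes both ratios \<open>St $ i $ i / S $ i $ i\<close> equal to a common number,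
  which is at most 1 by \<open>i = 1\<close> and at least 1 by the determinants; hence \<open>St $ 1 $ 1 = S $ 1 $ 1\<close> and
  \<open>St $ 1 $ 2 = 0\<close>.

  Third, these two equations force the coupling from \<open>x\<close> to \<open>y\<close> to be zero (\<open>coupling_vanishes\<close>).
  They say that, given the future of \<open>x\<close>, the variable \<open>x t\<close> is uncorrelated with the present and
  future of \<open>y\<close>. In the frequency domain this would equate a function analytic inside the unit disc
  with one analytic outside; in the time domain it yields a bounded solution of a recurrence whose
  nonzero solutions all grow exponentially (\<open>bounded_solution_of_stable_recurrence\<close>).
\<close>

(* Matrices of variable size and matrices indexed by a finite type share names; "$" keeps its
   meaning for the latter, while mat and det refer to the former. *)
no_notation vec_index (infixl "$" 100)
hide_const (open) Finite_Cartesian_Product.mat Determinants.det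

section \<open>Covariance as a semi-inner product\<close>

context prob_space
begin

lemma square_integrable_mult:
  assumes "square_integrable M X" "square_integrable M Y"
  shows "integrable M (\<lambda>w. X w * Y w)"
proof (rule Bochner_Integration.integrable_bound)
  show "integrable M (\<lambda>w. (X w)\<^sup>2 + (Y w)\<^sup>2)"
    using assms by (simp add: square_integrable_def)
  show "(\<lambda>w. X w * Y w) \<in> borel_measurable M"
    using assms by (auto simp: square_integrable_def)
  have "\<bar>u * v\<bar> \<le> u\<^sup>2 + v\<^sup>2" for u v :: real
    using sum_squares_bound[of "\<bar>u\<bar>" "\<bar>v\<bar>"] mult_nonneg_nonneg[of "\<bar>u\<bar>" "\<bar>v\<bar>"]
    unfolding abs_mult power2_abs by linarith
  then show "AE w in M. norm (X w * Y w) \<le> norm ((X w)\<^sup>2 + (Y w)\<^sup>2)"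
    by simp
qed

lemma square_integrable_integrable:
  assumes "square_integrable M X"
  shows "integrable M X"
  using assms by (auto simp: square_integrable_def intro: square_integrable_imp_integrable)

lemma square_integrable_add:
  assumes "square_integrable M X" "square_integrable M Y"
  shows "square_integrable M (\<lambda>w. X w + Y w)"
  using assms square_integrable_mult[OF assms]
  by (auto simp: square_integrable_def power2_sum mult.assoc)

lemma square_integrable_cmult:
  assumes "square_integrable M X"
  shows "square_integrable M (\<lambda>w. c * X w)"
  using assms by (auto simp: square_integrable_def power_mult_distrib)

lemma square_integrable_diff:
  assumes "square_integrable M X" "square_integrable M Y"
  shows "square_integrable M (\<lambda>w. X w - Y w)"
  using square_integrable_add[OF assms(1) square_integrable_cmult[OF assms(2), of "-1"]] by simp

lemma square_integrable_sum:
  assumes "\<And>i. i \<in> I \<Longrightarrow> square_integrable M (X i)"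
  shows "square_integrable M (\<lambda>w. \<Sum>i\<in>I. X i w)"
  using assms
proof (induction I rule: infinite_finite_induct)
  case (insert i I)
  then show ?case by (simp add: square_integrable_add)
qed (simp_all add: square_integrable_def)

lemma covar_moments:
  assumes "square_integrable M X" "square_integrable M Y"
  shows "covar M X Y = (\<integral>w. X w * Y w \<partial>M) - (\<integral>w. X w \<partial>M) * (\<integral>w. Y w \<partial>M)"
proof -
  note int = square_integrable_integrable[OF assms(1)] square_integrable_integrable[OF assms(2)]
    square_integrable_mult[OF assms]
  have "covar M X Y = (\<integral>w. X w * Y w - (\<integral>v. Y v \<partial>M) * X w - (\<integral>v. X v \<partial>M) * Y w
      + (\<integral>v. X v \<partial>M) * (\<integral>v. Y v \<partial>M) \<partial>M)"
    unfolding covar_def by (rule Bochner_Integration.integral_cong) (auto simp: algebra_simps)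
  also have "\<dots> = (\<integral>w. X w * Y w \<partial>M) - (\<integral>w. X w \<partial>M) * (\<integral>w. Y w \<partial>M)"
    using int by (simp add: prob_space)
  finally show ?thesis .
qed

lemma covar_commute: "covar M X Y = covar M Y X"
  by (simp add: covar_def mult.commute)

lemma covar_cong_AE:
  assumes "square_integrable M X" "square_integrable M X'" "square_integrable M Y"
    and "AE w in M. X w = X' w"
  shows "covar M X Y = covar M X' Y"
proof -
  have m: "X \<in> borel_measurable M" "X' \<in> borel_measurable M" "Y \<in> borel_measurable M"
    using assms by (auto simp: square_integrable_def)
  have "(\<integral>w. X w \<partial>M) = (\<integral>w. X' w \<partial>M)"
    using assms m by (intro integral_cong_AE) auto
  then show ?thesis
    unfolding covar_def using assms(4) m by (intro integral_cong_AE) auto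
qed

lemma covar_add_left:
  assumes "square_integrable M X" "square_integrable M Y" "square_integrable M U"
  shows "covar M (\<lambda>w. X w + Y w) U = covar M X U + covar M Y U"
  using assms
  by (simp add: covar_moments square_integrable_add square_integrable_mult
      square_integrable_integrable algebra_simps)

lemma covar_cmult_left:
  assumes "square_integrable M X" "square_integrable M U"
  shows "covar M (\<lambda>w. c * X w) U = c * covar M X U"
  using assms
  by (simp add: covar_moments square_integrable_cmult square_integrable_mult
      square_integrable_integrable algebra_simps)

lemma covar_diff_left:
  assumes "square_integrable M X" "square_integrable M Y" "square_integrable M U"
  shows "covar M (\<lambda>w. X w - Y w) U = covar M X U - covar M Y U"
  using assms
  by (simp add: covar_moments square_integrable_diff square_integrable_mult
      square_integrable_integrable algebra_simps)

lemma covar_sum_left: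
  assumes "\<And>i. i \<in> I \<Longrightarrow> square_integrable M (X i)" "square_integrable M U"
  shows "covar M (\<lambda>w. \<Sum>i\<in>I. X i w) U = (\<Sum>i\<in>I. covar M (X i) U)"
  using assms
proof (induction I rule: infinite_finite_induct)
  case (insert i I)
  then show ?case by (simp add: covar_add_left square_integrable_sum)
qed (simp_all add: covar_def)

lemma covar_cmult_right:
  assumes "square_integrable M X" "square_integrable M U"
  shows "covar M U (\<lambda>w. c * X w) = c * covar M U X"
  using covar_cmult_left[OF assms] by (simp add: covar_commute[of U])

lemma covar_diff_right:
  assumes "square_integrable M X" "square_integrable M Y" "square_integrable M U"
  shows "covar M U (\<lambda>w. X w - Y w) = covar M U X - covar M U Y"
  using covar_diff_left[OF assms] by (simp add: covar_commute[of U])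

lemma covar_sum_right:
  assumes "\<And>i. i \<in> I \<Longrightarrow> square_integrable M (X i)" "square_integrable M U"
  shows "covar M U (\<lambda>w. \<Sum>i\<in>I. X i w) = (\<Sum>i\<in>I. covar M U (X i))"
  using covar_sum_left[OF assms] by (simp add: covar_commute[of U])

lemma covar_self_nonneg: "0 \<le> covar M X X"
  unfolding covar_def by (rule Bochner_Integration.integral_nonneg) simp

lemma covar_Cauchy_Schwarz:
  assumes "square_integrable M X" "square_integrable M Y"
  shows "(covar M X Y)\<^sup>2 \<le> covar M X X * covar M Y Y"
proof -
  have q: "0 \<le> covar M X X - 2 * s * covar M X Y + s\<^sup>2 * covar M Y Y" for s
  proof -
    have "covar M (\<lambda>w. X w - s * Y w) (\<lambda>w. X w - s * Y w)
        = covar M X X - 2 * s * covar M X Y + s\<^sup>2 * covar M Y Y"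
      using assms covar_commute[of Y X]
      by (simp add: covar_diff_left covar_diff_right covar_cmult_left covar_cmult_right
          square_integrable_diff square_integrable_cmult power2_eq_square algebra_simps)
    then show ?thesis using covar_self_nonneg[of "\<lambda>w. X w - s * Y w"] by simp
  qed
  (* If Y has variance 0, the quadratic q is affine in s and bounded below, hence constant. *)
  show ?thesis
  proof (cases "covar M Y Y = 0")
    case False
    then have pos: "covar M Y Y > 0" using covar_self_nonneg[of Y] by simp
    have "0 \<le> covar M Y Y * (covar M X X - 2 * (covar M X Y / covar M Y Y) * covar M X Y
        + (covar M X Y / covar M Y Y)\<^sup>2 * covar M Y Y)"
      using q[of "covar M X Y / covar M Y Y"] pos by (intro mult_nonneg_nonneg) auto
    also have "\<dots> = covar M X X * covar M Y Y - (covar M X Y)\<^sup>2"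
      using pos by (simp add: field_simps power2_eq_square)
    finally show ?thesis by simp
  next
    case True
    have "covar M X Y = 0"
    proof (rule ccontr)
      assume "covar M X Y \<noteq> 0"
      then have "covar M X X - 2 * ((covar M X X + 1) / (2 * covar M X Y)) * covar M X Y = - 1"
        by (simp add: field_simps)
      with q[of "(covar M X X + 1) / (2 * covar M X Y)"] True show False by simp
    qed
    with True show ?thesis by simp
  qed
qed

lemma covar_eq_0_of_variance_0:
  assumes "square_integrable M X" "square_integrable M Y" "covar M X X = 0"
  shows "covar M X Y = 0"
  using covar_Cauchy_Schwarz[OF assms(1,2)] assms(3) by simp

end

section \<open>Vector autoregressions through their covariances\<close>

definition component :: "(int \<Rightarrow> 'w \<Rightarrow> real^'n) \<Rightarrow> 'n \<Rightarrow> int \<Rightarrow> 'w \<Rightarrow> real" where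
  "component z i t = (\<lambda>w. z t w $ i)"

locale VAR = prob_space M
  for M :: "'w measure" +
  fixes p :: nat and A :: "nat \<Rightarrow> real^'n^'n"
    and z e :: "int \<Rightarrow> 'w \<Rightarrow> real^'n"
  assumes stationary: "second_order_stationary M z"
    and representation: "VAR_representation M p A z e"
begin

abbreviation "Z \<equiv> component z"
abbreviation "E \<equiv> component e"
abbreviation "\<Sigma> \<equiv> residual_cov M e"

lemma white_noise: "white_noise M e"
  using representation by (simp add: VAR_representation_def)

lemma square_integrable_Z: "square_integrable M (Z i t)"
  using stationary by (simp add: second_order_stationary_def component_def)

lemma square_integrable_E: "square_integrable M (E i t)"
  using white_noise by (simp add: white_noise_def second_order_stationary_def component_def)

lemma covar_shift: "covar M (Z i (s + h)) (Z j (t + h)) = covar M (Z i s) (Z j t)"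
proof -
  have "cross_cov M (z u) (z (u - l)) = cross_cov M (z v) (z (v - l))" for u v l
    using stationary unfolding second_order_stationary_def by blast
  from this[of "s + h" "s - t" s] show ?thesis
    by (simp add: cross_cov_def component_def vec_eq_iff algebra_simps)
qed

lemma mean_E: "(\<integral>w. E i t w \<partial>M) = 0"
  using white_noise by (simp add: white_noise_def component_def)

lemma covar_E_moment:
  assumes "square_integrable M X"
  shows "covar M (E i t) X = (\<integral>w. E i t w * X w \<partial>M)"
  by (simp add: covar_moments square_integrable_E assms mean_E)

lemma covar_E_E: "covar M (E i s) (E j t) = (if s = t then \<Sigma> $ i $ j else 0)"
proof (cases "s = t")
  case True
  have "cross_cov M (e t) (e (t - 0)) = cross_cov M (e 0) (e (0 - 0))"
    using white_noise by (auto simp only: white_noise_def second_order_stationary_def)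
  then have "covar M (E i t) (E j t) = covar M (E i 0) (E j 0)"
    by (simp add: cross_cov_def component_def vec_eq_iff)
  then show ?thesis
    using True covar_E_moment[OF square_integrable_E, of i 0 j 0]
    by (simp add: residual_cov_def outer_moment_def component_def)
next
  case False
  then have "outer_moment M (e s) (e (s - (s - t))) = 0"
    using white_noise unfolding white_noise_def by (metis right_minus_eq)
  then show ?thesis
    using False by (simp add: covar_E_moment square_integrable_E) 
      (simp add: component_def outer_moment_def vec_eq_iff)
qed

lemma covar_E_past:
  assumes "s < t"
  shows "covar M (E i t) (Z j s) = 0"
proof -
  have "\<forall>h\<ge>1. outer_moment M (e t) (z (t - h)) = 0"
    using representation by (simp add: VAR_representation_def)
  then have "outer_moment M (e t) (z (t - (t - s))) = 0"
    using assms by (metis int_one_le_iff_zero_less diff_gt_0_iff_gt)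
  then show ?thesis
    by (simp add: covar_E_moment square_integrable_Z)
      (simp add: component_def outer_moment_def vec_eq_iff)
qed

text \<open>Almost sure equality enters only here: from now on the recursion is used through its
  covariances with square-integrable variables.\<close>

lemma covar_recursion:
  assumes U: "square_integrable M U"
  shows "covar M (Z i t) U
    = (\<Sum>k=1..p. \<Sum>j\<in>UNIV. A k $ i $ j * covar M (Z j (t - int k)) U) + covar M (E i t) U"
proof -
  let ?R = "\<lambda>w. (\<Sum>k=1..p. \<Sum>j\<in>UNIV. A k $ i $ j * Z j (t - int k) w) + E i t w"
  have "AE w in M. z t w = (\<Sum>k=1..p. A k *v z (t - int k) w) + e t w"
    using representation by (simp add: VAR_representation_def)
  then have "AE w in M. Z i t w = ?R w"
    by eventually_elim (simp add: component_def matrix_vector_mult_def)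
  then have "covar M (Z i t) U = covar M ?R U"
    by (intro covar_cong_AE U square_integrable_add square_integrable_sum
        square_integrable_cmult square_integrable_Z square_integrable_E)
  also have "\<dots> = (\<Sum>k=1..p. \<Sum>j\<in>UNIV. A k $ i $ j * covar M (Z j (t - int k)) U) + covar M (E i t) U"
    by (simp add: U covar_add_left covar_sum_left covar_cmult_left square_integrable_sum
        square_integrable_cmult square_integrable_Z square_integrable_E)
  finally show ?thesis .
qed

lemma covar_E_present: "covar M (E i t) (Z j t) = \<Sigma> $ i $ j"
proof -
  have "covar M (Z j t) (E i t) = covar M (E j t) (E i t)"
    by (subst covar_recursion[OF square_integrable_E])
      (simp add: covar_commute[of "Z _ _"] covar_E_past)
  then show ?thesis by (simp add: covar_commute[of _ "E i t"] covar_E_E)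
qed

text \<open>The innovation is orthogonal to \<open>Z - U - E\<close> as soon as it is orthogonal to the predictor \<open>U\<close>,
  so that Pythagoras applies.\<close>

lemma prediction_error_variance:
  assumes U: "square_integrable M U" and orth: "covar M (E i t) U = 0"
  defines "R \<equiv> \<lambda>w. Z i t w - U w"
  shows "covar M R R = \<Sigma> $ i $ i + covar M (\<lambda>w. R w - E i t w) (\<lambda>w. R w - E i t w)"
proof -
  have R: "square_integrable M R"
    unfolding R_def by (intro square_integrable_diff square_integrable_Z U)
  have "covar M (E i t) R = \<Sigma> $ i $ i"
    unfolding R_def by (simp add: covar_diff_right square_integrable_Z square_integrable_E U orth
        covar_E_present)
  then show ?thesis
    using covar_commute[of R "E i t"]
    by (simp add: covar_diff_left covar_diff_right R square_integrable_E square_integrable_diff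
        covar_E_E)
qed

lemma innovation_variance_minimal:
  assumes U: "square_integrable M U" and orth: "covar M (E i t) U = 0"
  shows "\<Sigma> $ i $ i \<le> covar M (\<lambda>w. Z i t w - U w) (\<lambda>w. Z i t w - U w)"
  using prediction_error_variance[OF assms] covar_self_nonneg by (simp)

text \<open>A predictor that attains the minimal variance has the innovation as its error, up to a
  variable of variance zero, which no covariance can see.\<close>

lemma optimal_prediction_error_unique:
  assumes U: "square_integrable M U" and orth: "covar M (E i t) U = 0"
    and opt: "covar M (\<lambda>w. Z i t w - U w) (\<lambda>w. Z i t w - U w) = \<Sigma> $ i $ i"
    and V: "square_integrable M V"
  shows "covar M (\<lambda>w. Z i t w - U w) V = covar M (E i t) V"
proof -
  have R: "square_integrable M (\<lambda>w. Z i t w - U w)"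
    by (intro square_integrable_diff square_integrable_Z U)
  have "covar M (\<lambda>w. Z i t w - U w - E i t w) (\<lambda>w. Z i t w - U w - E i t w) = 0"
    using prediction_error_variance[OF U orth] opt by simp
  then have "covar M (\<lambda>w. Z i t w - U w - E i t w) V = 0"
    by (rule covar_eq_0_of_variance_0[OF square_integrable_diff[OF R square_integrable_E] V])
  then show ?thesis by (simp add: covar_diff_left R square_integrable_E V)
qed

end

text \<open>Time reversal keeps the lag covariances up to transposition, hence stationarity.\<close>

lemma (in prob_space) second_order_stationary_time_reverse:
  assumes "second_order_stationary M z"
  shows "second_order_stationary M (time_reverse z)"
proof -
  have eq: "cross_cov M (z (- s)) (z (- (s - h))) = cross_cov M (z (- t)) (z (- (t - h)))" for s t h
  proof -
    have "cross_cov M (z (- (s - h))) (z (- (s - h) - h)) = cross_cov M (z (- (t - h))) (z (- (t - h) - h))"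
      using assms by (simp only: second_order_stationary_def)
    then show ?thesis
      by (simp add: cross_cov_def vec_eq_iff) (metis covar_commute)
  qed
  show ?thesis
    unfolding second_order_stationary_def time_reverse_def
    using assms eq by (simp add: second_order_stationary_def)
qed

lemma residual_cov_time_reverse: "residual_cov M (time_reverse e) = residual_cov M e"
  by (simp add: residual_cov_def time_reverse_def)

lemma component_time_reverse: "component (time_reverse z) i = time_reverse (component z i)"
  by (simp add: component_def time_reverse_def fun_eq_iff)

section \<open>Finite-order prediction errors and univariate residuals\<close>

definition lag_error :: "(nat \<Rightarrow> real) \<Rightarrow> nat \<Rightarrow> (int \<Rightarrow> 'w \<Rightarrow> real) \<Rightarrow> int \<Rightarrow> 'w \<Rightarrow> real" where
  "lag_error c n x t = (\<lambda>w. x t w - (\<Sum>k=1..n. c k * x (t - int k) w))"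

context prob_space
begin

lemma square_integrable_lag_error:
  assumes "\<And>t. square_integrable M (x t)"
  shows "square_integrable M (lag_error c n x t)"
  unfolding lag_error_def
  by (intro square_integrable_diff square_integrable_sum square_integrable_cmult assms)

lemma covar_lag_error_left:
  assumes "\<And>t. square_integrable M (x t)" "square_integrable M U"
  shows "covar M (lag_error c n x t) U
    = covar M (x t) U - (\<Sum>k=1..n. c k * covar M (x (t - int k)) U)"
  unfolding lag_error_def
  by (simp add: assms covar_diff_left covar_sum_left covar_cmult_left square_integrable_sum
      square_integrable_cmult)

lemma covar_lag_error_right:
  assumes "\<And>t. square_integrable M (x t)" "square_integrable M U"
  shows "covar M U (lag_error c n x t)
    = covar M U (x t) - (\<Sum>k=1..n. c k * covar M U (x (t - int k)))"
  using covar_lag_error_left[OF assms] by (simp add: covar_commute[of U])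

lemma lag_error_variance_cong:
  assumes "\<And>t. square_integrable M (x t)" "\<And>t. square_integrable M (y t)"
    and "\<And>j k :: nat. covar M (x (s - int j)) (x (s - int k)) = covar M (y (t - int j)) (y (t - int k))"
  shows "covar M (lag_error c n x s) (lag_error c n x s)
    = covar M (lag_error c n y t) (lag_error c n y t)"
  using assms(3)[of 0 0] assms(3)[of 0] assms(3)[of _ 0] assms(3)
  by (simp add: covar_lag_error_left covar_lag_error_right assms(1,2) square_integrable_lag_error)

lemma residual_var_covar: "residual_var M xi = covar M (xi 0) (xi 0)"
  by (simp add: residual_var_def covar_def power2_eq_square)

text \<open>The mean square of \<open>X n - Y\<close> dominates its variance, and by Cauchy--Schwarz also the square of its
  covariance with \<open>Y\<close> up to a constant factor.\<close>

lemma variance_tendsto: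
  assumes X: "\<And>n. square_integrable M (X n)" and Y: "square_integrable M Y"
    and lim: "(\<lambda>n. \<integral>w. (X n w - Y w)\<^sup>2 \<partial>M) \<longlonglongrightarrow> 0"
  shows "(\<lambda>n. covar M (X n) (X n)) \<longlonglongrightarrow> covar M Y Y"
proof -
  define D where "D n = (\<lambda>w. X n w - Y w)" for n
  have D: "square_integrable M (D n)" for n
    unfolding D_def by (intro square_integrable_diff X Y)
  have le: "covar M (D n) (D n) \<le> (\<integral>w. (X n w - Y w)\<^sup>2 \<partial>M)" for n
    using covar_moments[OF D D, of n n] by (simp add: D_def power2_eq_square)
  have DD: "(\<lambda>n. covar M (D n) (D n)) \<longlonglongrightarrow> 0"
    by (rule tendsto_sandwich[OF _ _ tendsto_const lim]) (auto simp: covar_self_nonneg le)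
  have YD: "(\<lambda>n. covar M Y (D n)) \<longlonglongrightarrow> 0"
  proof (rule Lim_null_comparison)
    show "\<forall>\<^sub>F n in sequentially. norm (covar M Y (D n)) \<le> sqrt (covar M Y Y * covar M (D n) (D n))"
      using covar_Cauchy_Schwarz[OF Y D] real_le_rsqrt
      by (intro always_eventually allI) (auto intro: real_le_rsqrt)
    show "(\<lambda>n. sqrt (covar M Y Y * covar M (D n) (D n))) \<longlonglongrightarrow> 0"
      using tendsto_real_sqrt[OF tendsto_mult_left[OF DD, of "covar M Y Y"]] by simp
  qed
  have "covar M (X n) (X n) = covar M Y Y + 2 * covar M Y (D n) + covar M (D n) (D n)" for n
    using covar_commute[of Y "X n"] unfolding D_def
    by (simp add: covar_diff_left covar_diff_right X Y square_integrable_diff)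
  then show ?thesis
    using tendsto_add[OF tendsto_add[OF tendsto_const tendsto_mult_left[OF YD, of 2]] DD]
    by simp
qed

text \<open>This turns the variance of an infinite-order residual into a limit of expressions in the
  autocovariances.\<close>

lemma AR_residual_variance_limit:
  assumes rep: "AR_representation M c x xi" and L2: "\<And>t. square_integrable M (x t)"
  shows "(\<lambda>n. covar M (lag_error c n x 0) (lag_error c n x 0)) \<longlonglongrightarrow> residual_var M xi"
  unfolding residual_var_covar
proof (rule variance_tendsto)
  show "square_integrable M (lag_error c n x 0)" for n
    by (rule square_integrable_lag_error[OF L2])
  show "square_integrable M (xi 0)"
    using rep by (simp add: AR_representation_def)
  show "(\<lambda>n. \<integral>w. (lag_error c n x 0 w - xi 0 w)\<^sup>2 \<partial>M) \<longlonglongrightarrow> 0"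
    using rep unfolding AR_representation_def lag_error_def by blast
qed

text \<open>The forward and the reversed representation have the same coefficients, and the variances of
  their partial sums agree when the autocovariance is an even function of the lag.\<close>

lemma AR_residual_var_time_reverse:
  assumes rep: "AR_representation M c x xi" and rev: "reversed_AR_representation M c x xit"
    and L2: "\<And>t. square_integrable M (x t)"
    and sym: "\<And>s t. covar M (x (- s)) (x (- t)) = covar M (x s) (x t)"
  shows "residual_var M xit = residual_var M xi"
proof -
  have L2': "square_integrable M (time_reverse x t)" for t
    using L2 by (simp add: time_reverse_def)
  have "covar M (lag_error c n (time_reverse x) 0) (lag_error c n (time_reverse x) 0)
      = covar M (lag_error c n x 0) (lag_error c n x 0)" for n
    by (rule lag_error_variance_cong[OF L2' L2]) (use sym[of "- int _" "- int _"] in \<open>simp add: time_reverse_def\<close>)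
  then have "(\<lambda>n. covar M (lag_error c n x 0) (lag_error c n x 0))
      \<longlonglongrightarrow> residual_var M (time_reverse xit)"
    using AR_residual_variance_limit[OF rev[unfolded reversed_AR_representation_def] L2'] by simp
  then have "residual_var M (time_reverse xit) = residual_var M xi"
    using AR_residual_variance_limit[OF rep L2] LIMSEQ_unique by blast
  then show ?thesis by (simp add: residual_var_def time_reverse_def)
qed

end

section \<open>Bounded solutions of stable recurrences\<close>

text \<open>Let \<open>P\<close> act on sequences with its variable as the shift. A linear factor with root \<open>r\<close>,
  \<open>\<bar>r\<bar> > 1\<close>, annihilates only the multiples of the unbounded sequence \<open>r ^ n\<close>, so the
  factors of \<open>P\<close> can be cancelled one by one.

  The sum runs up to an arbitrary \<open>N \<ge> degree P\<close> because the polynomial of a recurrence of order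
  \<open>p\<close> may have degree below \<open>p\<close>.\<close>

lemma bounded_solution_of_stable_recurrence_poly:
  fixes P :: "complex poly" and u :: "nat \<Rightarrow> complex"
  assumes "\<And>l. norm l \<le> 1 \<Longrightarrow> poly P l \<noteq> 0"
    and "degree P \<le> N"
    and "\<And>n. norm (u n) \<le> B"
    and "\<And>n. (\<Sum>k\<le>N. coeff P k * u (n + k)) = 0"
  shows "u n = 0"
  using assms
proof (induction "degree P" arbitrary: P N n)
  case 0
  then obtain c where P: "P = [:c:]" by (metis degree_eq_zeroE)
  with 0(2)[of 0] have "c \<noteq> 0" by simp
  moreover have "(\<Sum>k\<le>N. coeff P k * u (n + k)) = c * u n"
  proof -
    have "(\<Sum>k\<le>N. coeff P k * u (n + k)) = (\<Sum>k\<in>{0}. coeff P k * u (n + k))"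
      by (rule sum.mono_neutral_right) (auto simp: P coeff_pCons split: nat.splits)
    then show ?thesis by (simp add: P)
  qed
  ultimately show ?case using 0(5)[of n] by simp
next
  case (Suc d)
  have "\<not> constant (poly P)"
    using Suc(2) by (simp add: constant_degree)
  then obtain r where r: "poly P r = 0"
    using fundamental_theorem_of_algebra by blast
  then obtain Q where Q: "P = [:- r, 1:] * Q"
    using poly_eq_0_iff_dvd by (metis dvdE)
  have r1: "norm r > 1" using Suc(3)[of r] r by force
  have Q0: "Q \<noteq> 0" using Q Suc(2) by auto
  have degQ: "d = degree Q"
    using Suc(2) Q0 unfolding Q by (subst (asm) degree_mult_eq) auto
  have rootQ: "poly Q l \<noteq> 0" if "norm l \<le> 1" for l
    using Suc(3)[OF that] unfolding Q by auto
  define v where "v n = (\<Sum>k\<le>d. coeff Q k * u (n + k))" for n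
  have step: "v (Suc n) = r * v n" for n
  proof -
    have ext: "(\<Sum>k\<le>N. coeff P k * u (n + k)) = (\<Sum>k\<le>Suc d. coeff P k * u (n + k))"
      using Suc(2,4) by (intro sum.mono_neutral_right) (auto simp: coeff_eq_0)
    have c: "coeff P k = coeff (pCons 0 Q) k - r * coeff Q k" for k
      unfolding Q by (simp add: algebra_simps)
    have "(\<Sum>k\<le>Suc d. coeff P k * u (n + k))
        = (\<Sum>k\<le>Suc d. coeff (pCons 0 Q) k * u (n + k)) - r * (\<Sum>k\<le>Suc d. coeff Q k * u (n + k))"
      by (simp only: c left_diff_distrib sum_subtractf sum_distrib_left mult.assoc)
    also have "(\<Sum>k\<le>Suc d. coeff (pCons 0 Q) k * u (n + k)) = v (Suc n)"
      unfolding v_def by (subst sum.atMost_Suc_shift) simp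
    also have "(\<Sum>k\<le>Suc d. coeff Q k * u (n + k)) = v n"
      unfolding v_def by (simp add: coeff_eq_0 degQ)
    finally show ?thesis using Suc(6)[of n] ext by simp
  qed
  have pow: "v (n + m) = r ^ m * v n" for n m
    by (induction m) (simp_all add: step)
  define C where "C = (\<Sum>k\<le>d. norm (coeff Q k) * B)"
  have bound: "norm (v n) \<le> C" for n
    unfolding v_def C_def
    by (rule order_trans[OF norm_sum]) (intro sum_mono, simp add: norm_mult mult_left_mono Suc(5))
  have v0: "v n = 0" for n
  proof (rule ccontr)
    assume "v n \<noteq> 0"
    then have pos: "norm (v n) > 0" by simp
    obtain m where "C / norm (v n) < norm r ^ m"
      using real_arch_pow[OF r1] by blast
    with pos have "C < norm r ^ m * norm (v n)" by (simp add: field_simps)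
    also have "\<dots> = norm (v (n + m))" by (simp add: pow norm_mult norm_power)
    finally show False using bound[of "n + m"] by simp
  qed
  show ?case
    by (rule Suc(1)[OF degQ rootQ _ Suc(5), of d]) (use v0 degQ in \<open>auto simp: v_def\<close>)
qed

text \<open>A causal recurrence expresses each value by earlier ones. Read backwards in time it takes the
  present form, whose solutions \<open>r ^ n\<close> have the roots \<open>r\<close> of the stability polynomial themselves as
  ratios, and not their inverses.\<close>

lemma bounded_solution_of_stable_recurrence:
  fixes d u :: "nat \<Rightarrow> real"
  assumes stable: "\<And>l::complex. norm l \<le> 1 \<Longrightarrow> 1 - (\<Sum>k=1..p. of_real (d k) * l ^ k) \<noteq> 0"
    and bounded: "\<And>n. \<bar>u n\<bar> \<le> B"
    and recurrence: "\<And>n. u n = (\<Sum>k=1..p. d k * u (n + k))"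
  shows "u n = 0"
proof -
  define P :: "complex poly" where "P = 1 - (\<Sum>k=1..p. monom (of_real (d k)) k)"
  have "poly P l = 1 - (\<Sum>k=1..p. of_real (d k) * l ^ k)" for l
    by (simp add: P_def poly_sum poly_monom)
  then have roots: "poly P l \<noteq> 0" if "norm l \<le> 1" for l using stable that by simp
  have coeff: "coeff P k = (if k = 0 then 1 else if k \<le> p then - of_real (d k) else 0)" for k
  proof -
    have "coeff P k = coeff 1 k - (\<Sum>j=1..p. if j = k then of_real (d j) else 0)"
      by (simp add: P_def coeff_sum)
    then show ?thesis by (auto simp: sum.delta)
  qed
  have deg: "degree P \<le> p"
    by (rule degree_le) (simp add: coeff)
  have rec: "(\<Sum>k\<le>p. coeff P k * complex_of_real (u (n + k))) = 0" for n
  proof -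
    have "{..p} = insert 0 {1..p}" by auto
    then have "(\<Sum>k\<le>p. coeff P k * complex_of_real (u (n + k)))
        = complex_of_real (u n) - (\<Sum>k=1..p. of_real (d k * u (n + k)))"
      by (simp add: coeff sum_negf)
    also have "\<dots> = complex_of_real (u n - (\<Sum>k=1..p. d k * u (n + k)))" by simp
    finally show ?thesis using recurrence[of n] by simp
  qed
  have "complex_of_real (u n) = 0"
    by (rule bounded_solution_of_stable_recurrence_poly[OF roots deg, of _ B])
      (use bounded rec in auto)
  then show ?thesis by simp
qed

section \<open>Determinants of stacked covariance matrices\<close>

lemma det_simultaneous_permutation:
  fixes B :: "'a::comm_ring_1 mat"
  assumes B: "B \<in> carrier_mat n n" and pi: "\<pi> permutes {0..<n}"
  shows "det (mat n n (\<lambda>(i,j). B $$ (\<pi> i, \<pi> j))) = det B"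
proof -
  define B1 where "B1 = transpose_mat (mat n n (\<lambda>(i,j). B $$ (\<pi> i, j)))"
  have B1: "B1 \<in> carrier_mat n n" by (simp add: B1_def)
  have lt: "\<pi> i < n" if "i < n" for i
    using permutes_in_image[OF pi, of i] that by simp
  have eq: "transpose_mat (mat n n (\<lambda>(i,j). B1 $$ (\<pi> i, j)))
      = mat n n (\<lambda>(i,j). B $$ (\<pi> i, \<pi> j))"
    by (rule eq_matI) (auto simp: B1_def lt)
  have "det (mat n n (\<lambda>(i,j). B $$ (\<pi> i, \<pi> j))) = det (mat n n (\<lambda>(i,j). B1 $$ (\<pi> i, j)))"
    unfolding eq[symmetric] by (rule Determinant.det_transpose[where n = n]) simp
  also have "\<dots> = signof \<pi> * det B1"
    by (rule Determinant.det_permute_rows[OF B1 pi])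
  also have "det B1 = signof \<pi> * det B"
    unfolding B1_def using Determinant.det_permute_rows[OF B pi] Determinant.det_transpose[of "mat n n (\<lambda>(i,j). B $$ (\<pi> i, j))" n]
    by simp
  also have "signof \<pi> * (signof \<pi> * det B) = det B"
    by (auto simp: sign_def)
  finally show ?thesis .
qed

lemma det_mat_2: "det (mat 2 2 f :: real mat) = f (0,0) * f (1,1) - f (0,1) * f (1,0)"
proof -
  have f2: "finite {Suc 0}" "0 \<notin> {Suc 0}" by auto
  have "{0..<2} = {0, 1::nat}" by auto
  then show ?thesis
    unfolding Determinant.det_def
    by (simp add: sum_over_permutations_insert[OF f2] permutes_sing sign_swap_id sign_id swap_id_eq)
qed

text \<open>Position \<open>i\<close> of the stacked vector \<open>(z 0, z 1, \<dots>)\<close> holds component \<open>stacked_index i\<close> of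
  \<open>z (i div 2)\<close>.\<close>

definition stacked_index :: "nat \<Rightarrow> 2" where
  "stacked_index i = (if even i then 1 else 2)"

definition stacked_cov :: "'w measure \<Rightarrow> (int \<Rightarrow> 'w \<Rightarrow> real^2) \<Rightarrow> nat \<Rightarrow> real mat" where
  "stacked_cov M z n = mat (2 * n) (2 * n) (\<lambda>(i,j).
     covar M (component z (stacked_index i) (int (i div 2)))
             (component z (stacked_index j) (int (j div 2))))"

lemma stacked_cov_carrier: "stacked_cov M z n \<in> carrier_mat (2 * n) (2 * n)"
  by (simp add: stacked_cov_def)

lemma sum_stacked:
  "(\<Sum>m<2 * n. f (m div 2) (stacked_index m)) = (\<Sum>k<n. \<Sum>j\<in>UNIV. f k j)"
  by (induction n) (simp_all add: stacked_index_def sum_2 lessThan_Suc algebra_simps)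

lemma sum_stacked_lags:
  "(\<Sum>m<2 * n. f (n - m div 2) (stacked_index m)) = (\<Sum>k=1..n. \<Sum>j\<in>UNIV. f k j)"
proof -
  have "(\<Sum>m<2 * n. f (n - m div 2) (stacked_index m)) = (\<Sum>k<n. \<Sum>j\<in>UNIV. f (n - k) j)"
    by (rule sum_stacked)
  also have "\<dots> = (\<Sum>k=1..n. \<Sum>j\<in>UNIV. f k j)"
    by (rule sum.reindex_bij_witness[of _ "\<lambda>k. n - k" "\<lambda>k. n - k"]) auto
  finally show ?thesis .
qed

locale bivariate_VAR = VAR M p A z e
  for M :: "'w measure" and p :: nat and A :: "nat \<Rightarrow> real^2^2"
    and z e :: "int \<Rightarrow> 'w \<Rightarrow> real^2"
begin

text \<open>Reversing time reverses the order of the blocks; stationarity moves the time window back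
  from \<open>{- (n - 1)..0}\<close> to \<open>{0..n - 1}\<close>.\<close>

lemma det_stacked_cov_time_reverse:
  "det (stacked_cov M (time_reverse z) n) = det (stacked_cov M z n)"
proof -
  define \<pi> where "\<pi> i = (if i < 2 * n then 2 * (n - 1 - i div 2) + i mod 2 else i)" for i :: nat
  have inv: "\<pi> (\<pi> i) = i" for i
    unfolding \<pi>_def by (cases "even i") (auto elim!: evenE oddE)
  have lt: "\<pi> i < 2 * n" if "i < 2 * n" for i
    using that unfolding \<pi>_def by (cases "even i") (auto elim!: evenE oddE)
  have "bij_betw \<pi> {0..<2 * n} {0..<2 * n}"
    by (rule bij_betw_byWitness[of _ \<pi>]) (auto simp: inv lt)
  then have perm: "\<pi> permutes {0..<2 * n}"
    by (rule bij_imp_permutes) (simp add: \<pi>_def)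
  have idx: "stacked_index (\<pi> i) = stacked_index i"
    and time: "int (\<pi> i div 2) = - int (i div 2) + (int n - 1)" if "i < 2 * n" for i
    using that unfolding \<pi>_def stacked_index_def by auto
  have "stacked_cov M (time_reverse z) n
      = mat (2 * n) (2 * n) (\<lambda>(i,j). stacked_cov M z n $$ (\<pi> i, \<pi> j))"
  proof (rule eq_matI)
    fix i j
    assume "i < dim_row (mat (2 * n) (2 * n) (\<lambda>(i,j). stacked_cov M z n $$ (\<pi> i, \<pi> j)))"
      and "j < dim_col (mat (2 * n) (2 * n) (\<lambda>(i,j). stacked_cov M z n $$ (\<pi> i, \<pi> j)))"
    then have ij: "i < 2 * n" "j < 2 * n" by simp_all
    have "stacked_cov M z n $$ (\<pi> i, \<pi> j)
        = covar M (Z (stacked_index i) (- int (i div 2) + (int n - 1)))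
                  (Z (stacked_index j) (- int (j div 2) + (int n - 1)))"
      unfolding stacked_cov_def using ij lt idx time by (simp del: of_nat_div)
    also have "\<dots> = stacked_cov M (time_reverse z) n $$ (i,j)"
      unfolding covar_shift using ij
      by (simp add: stacked_cov_def component_time_reverse time_reverse_def del: of_nat_div)
    finally show "stacked_cov M (time_reverse z) n $$ (i,j)
        = mat (2 * n) (2 * n) (\<lambda>(i,j). stacked_cov M z n $$ (\<pi> i, \<pi> j)) $$ (i,j)"
      using ij by simp
  qed (simp_all add: stacked_cov_def)
  then show ?thesis
    by (simp add: det_simultaneous_permutation[OF stacked_cov_carrier perm])
qed

text \<open>Subtracting from the last block of rows its regression on the earlier ones replaces \<open>z p\<close> by
  the innovation \<open>e p\<close> in the row position only. The innovation has covariance \<open>0\<close> with the earlier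
  variables and \<open>\<Sigma>\<close> with \<open>z p\<close> itself, so the matrix becomes block upper triangular.\<close>

lemma det_stacked_cov_Suc:
  "det (stacked_cov M z (p + 1))
    = det (stacked_cov M z p) * (\<Sigma> $ 1 $ 1 * \<Sigma> $ 2 $ 2 - \<Sigma> $ 1 $ 2 * \<Sigma> $ 2 $ 1)"
proof -
  let ?x = stacked_index and ?N = "2 * p + 2" and ?G = "stacked_cov M z (p + 1)"
  (* Rows 2p and 2p + 1 of L hold the coefficients of e p in terms of z 0, ..., z p. *)
  define L :: "real mat" where "L = mat ?N ?N (\<lambda>(i,j).
     if i < 2 * p \<or> 2 * p \<le> j then (if i = j then 1 else 0) else - A (p - j div 2) $ ?x i $ ?x j)"
  have L: "L \<in> carrier_mat ?N ?N" by (simp add: L_def)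
  have G: "?G \<in> carrier_mat ?N ?N" by (simp add: stacked_cov_def)
  have "det L = prod_list (diag_mat L)"
    by (rule det_lower_triangular[OF _ L]) (auto simp: L_def)
  also have "\<dots> = (\<Prod>i=0..<?N. L $$ (i,i))"
    by (simp add: prod_list_diag_prod L_def)
  also have "\<dots> = 1"
    by (rule prod.neutral) (auto simp: L_def)
  finally have detL: "det L = 1" .
  define X where "X = mat (2 * p) 2 (\<lambda>(i,j). ?G $$ (i, j + 2 * p))"
  define S where "S = mat 2 2 (\<lambda>(i,j). \<Sigma> $ ?x i $ ?x j)"
  have entry: "(L * ?G) $$ (i,j) = (\<Sum>m<?N. L $$ (i,m) * ?G $$ (m,j))" if "i < ?N" "j < ?N" for i j
    using that L G by (auto simp: scalar_prod_def atLeast0LessThan)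
  have top: "(L * ?G) $$ (i,j) = ?G $$ (i,j)" if ij: "i < 2 * p" "j < ?N" for i j
  proof -
    have "(L * ?G) $$ (i,j) = (\<Sum>m<?N. if m = i then ?G $$ (i,j) else 0)"
      unfolding entry[OF trans_less_add1[OF ij(1)] ij(2)]
      by (rule sum.cong) (use ij in \<open>auto simp: L_def\<close>)
    then show ?thesis using ij by simp
  qed
  have bottom: "(L * ?G) $$ (i,j) = covar M (E (?x i) (int p)) (Z (?x j) (int (j div 2)))"
    if ij: "2 * p \<le> i" "i < ?N" "j < ?N" for i j
  proof -
    let ?U = "Z (?x j) (int (j div 2))"
    have i: "i div 2 = p" using ij by auto
    have "(L * ?G) $$ (i,j) = (\<Sum>m<2 * p. L $$ (i,m) * ?G $$ (m,j))
        + (\<Sum>m\<in>{2 * p..<?N}. L $$ (i,m) * ?G $$ (m,j))"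
      unfolding entry[OF ij(2,3)]
      using sum.atLeastLessThan_concat[of 0 "2 * p" ?N "\<lambda>m. L $$ (i,m) * ?G $$ (m,j)"]
      by (simp add: atLeast0LessThan)
    also have "(\<Sum>m\<in>{2 * p..<?N}. L $$ (i,m) * ?G $$ (m,j))
        = (\<Sum>m\<in>{2 * p..<?N}. if m = i then ?G $$ (i,j) else 0)"
      by (rule sum.cong) (use ij in \<open>auto simp: L_def\<close>)
    also have "\<dots> = covar M (Z (?x i) (int p)) ?U"
      using ij i by (simp add: stacked_cov_def)
    also have "(\<Sum>m<2 * p. L $$ (i,m) * ?G $$ (m,j))
        = (\<Sum>m<2 * p. - (A (p - m div 2) $ ?x i $ ?x m
            * covar M (Z (?x m) (int p - int (p - m div 2))) ?U))"
    proof (rule sum.cong[OF refl])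
      fix m assume "m \<in> {..<2 * p}"
      then have m: "m < 2 * p" "m < ?N" "int p - int (p - m div 2) = int (m div 2)" by auto
      then show "L $$ (i,m) * ?G $$ (m,j) = - (A (p - m div 2) $ ?x i $ ?x m
            * covar M (Z (?x m) (int p - int (p - m div 2))) ?U)"
        using ij unfolding m(3) by (simp add: L_def stacked_cov_def)
    qed
    also have "\<dots> = - (\<Sum>k=1..p. \<Sum>l\<in>UNIV. A k $ ?x i $ l * covar M (Z l (int p - int k)) ?U)"
      unfolding sum_negf
      by (subst sum_stacked_lags[of "\<lambda>k l. A k $ ?x i $ l * covar M (Z l (int p - int k)) ?U"]) simp
    finally show ?thesis
      using covar_recursion[OF square_integrable_Z, of "?x i" "int p" "?x j" "int (j div 2)"] by simp
  qed
  have "L * ?G = four_block_mat (stacked_cov M z p) X (0\<^sub>m 2 (2 * p)) S"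
  proof (rule eq_matI)
    fix i j
    assume "i < dim_row (four_block_mat (stacked_cov M z p) X (0\<^sub>m 2 (2 * p)) S)"
      and "j < dim_col (four_block_mat (stacked_cov M z p) X (0\<^sub>m 2 (2 * p)) S)"
    then have ij: "i < ?N" "j < ?N" by (auto simp: stacked_cov_def S_def)
    show "(L * ?G) $$ (i,j) = four_block_mat (stacked_cov M z p) X (0\<^sub>m 2 (2 * p)) S $$ (i,j)"
    proof (cases "i < 2 * p")
      case True
      show ?thesis
        using True ij unfolding top[OF True ij(2)] by (auto simp: X_def S_def stacked_cov_def)
    next
      case False
      then have i: "2 * p \<le> i" by simp
      show ?thesis
      proof (cases "j < 2 * p")
        case True
        then have "int (j div 2) < int p" by auto
        then show ?thesis
          unfolding bottom[OF i ij] using ij False True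
          by (simp add: S_def stacked_cov_def covar_E_past del: of_nat_div)
      next
        case j: False
        then have d: "j div 2 = p" using ij by auto
        have x: "?x (k - 2 * p) = ?x k" if "\<not> k < 2 * p" for k
          using that by (simp add: stacked_index_def)
        show ?thesis
          unfolding bottom[OF i ij] d using ij False j
          by (simp add: S_def stacked_cov_def covar_E_present x)
      qed
    qed
  qed (use L G in \<open>auto simp: stacked_cov_def S_def\<close>)
  then have "det (L * ?G) = det (stacked_cov M z p) * det S"
    by (simp add: det_four_block_mat_lower_left_zero[where n = "2 * p" and m = 2]
        stacked_cov_carrier X_def S_def)
  moreover have "det S = \<Sigma> $ 1 $ 1 * \<Sigma> $ 2 $ 2 - \<Sigma> $ 1 $ 2 * \<Sigma> $ 2 $ 1"
    by (simp add: S_def det_mat_2 stacked_index_def)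
  ultimately show ?thesis
    using det_mult[OF L G] detL by simp
qed

text \<open>A linear combination of the \<open>z t\<close> of variance zero is uncorrelated with every innovation.
  The innovation in the position of the last nonzero coefficient detects just that coefficient,
  since it is uncorrelated with all earlier positions.\<close>

lemma det_stacked_cov_nonzero:
  assumes diag: "diagonal_matrix \<Sigma>" and pos: "\<And>i. \<Sigma> $ i $ i > 0"
  shows "det (stacked_cov M z n) \<noteq> 0"
proof
  let ?x = stacked_index
  let ?Y = "\<lambda>m. Z (?x m) (int (m div 2))"
  assume "det (stacked_cov M z n) = 0"
  then obtain v where v: "v \<in> carrier_vec (2 * n)" "v \<noteq> 0\<^sub>v (2 * n)"
      "stacked_cov M z n *\<^sub>v v = 0\<^sub>v (2 * n)"
    using det_0_iff_vec_prod_zero_field[OF stacked_cov_carrier] by blast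
  define c where "c m = vec_index v m" for m
  define U where "U = (\<lambda>w. \<Sum>m<2 * n. c m * ?Y m w)"
  have U: "square_integrable M U"
    unfolding U_def by (intro square_integrable_sum square_integrable_cmult square_integrable_Z)
  have row: "covar M (?Y i) U = 0" if "i < 2 * n" for i
  proof -
    have "vec_index (stacked_cov M z n *\<^sub>v v) i = 0" using v(3) that by simp
    then have "(\<Sum>m<2 * n. stacked_cov M z n $$ (i,m) * c m) = 0"
      using that v(1) by (simp add: stacked_cov_def scalar_prod_def c_def atLeast0LessThan)
    then show ?thesis
      using that unfolding U_def
      by (simp add: covar_sum_right covar_cmult_right square_integrable_Z square_integrable_cmult
          stacked_cov_def mult.commute del: of_nat_div)
  qed
  have "covar M U U = (\<Sum>m<2 * n. c m * covar M (?Y m) U)"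
    by (subst (1) U_def)
      (simp add: covar_sum_left covar_cmult_left square_integrable_Z square_integrable_cmult U)
  then have U0: "covar M U U = 0" by (simp add: row del: of_nat_div)
  define m where "m = Max {m. m < 2 * n \<and> c m \<noteq> 0}"
  have fin: "finite {m. m < 2 * n \<and> c m \<noteq> 0}" by simp
  have "\<exists>m<2 * n. c m \<noteq> 0"
  proof (rule ccontr)
    assume "\<not> (\<exists>m<2 * n. c m \<noteq> 0)"
    then have "v = 0\<^sub>v (2 * n)" using v(1) by (intro eq_vecI) (auto simp: c_def)
    with v(2) show False by simp
  qed
  then have "m \<in> {m. m < 2 * n \<and> c m \<noteq> 0}"
    unfolding m_def using fin by (intro Max_in) auto
  then have m: "m < 2 * n" "c m \<noteq> 0" by auto
  have above: "c l = 0" if "m < l" "l < 2 * n" for l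
  proof (rule ccontr)
    assume "c l \<noteq> 0"
    with that have "l \<le> m" unfolding m_def by (intro Max_ge fin) simp
    with that show False by simp
  qed
  let ?E = "E (?x m) (int (m div 2))"
  have summand: "c l * covar M ?E (?Y l) = (if l = m then c m * \<Sigma> $ ?x m $ ?x m else 0)"
    if "l < 2 * n" for l
  proof -
    consider "l = m" | "m < l" | "l div 2 < m div 2" | "l < m" "l div 2 = m div 2"
      using div_le_mono[of l m 2] by linarith
    then show ?thesis
    proof cases
      case 1 then show ?thesis by (simp add: covar_E_present del: of_nat_div)
    next
      case 2 then show ?thesis using above that by simp
    next
      case 3
      then have "int (l div 2) < int (m div 2)" by simp
      with 3 show ?thesis by (auto simp add: covar_E_past simp del: of_nat_div)
    next
      case 4
      then have "even l" "odd m" by presburger+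
      then have "\<Sigma> $ ?x m $ ?x l = 0"
        using diag by (simp add: diagonal_matrix_def stacked_index_def)
      with 4 show ?thesis by (simp add: covar_E_present del: of_nat_div)
    qed
  qed
  have "0 = covar M ?E U"
    using covar_eq_0_of_variance_0[OF U square_integrable_E U0] by (simp add: covar_commute)
  also have "\<dots> = (\<Sum>l<2 * n. c l * covar M ?E (?Y l))"
    unfolding U_def
    by (simp add: covar_sum_right covar_cmult_right square_integrable_Z square_integrable_E
        square_integrable_cmult del: of_nat_div)
  also have "\<dots> = c m * \<Sigma> $ ?x m $ ?x m"
    using m by (simp add: summand del: of_nat_div)
  finally show False using m(2) pos[of "?x m"] by simp
qed

end

section \<open>Components driven by their own past\<close>

context VAR
begin

lemma covar_Z_reflect: "covar M (Z i (- s)) (Z i (- t)) = covar M (Z i s) (Z i t)"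
  using covar_shift[of i "- s" "s + t" i "- t"] by (simp add: covar_commute)

text \<open>In a lower triangular bivariate system this holds of the first component, in a diagonal one
  of both.\<close>

definition autonomous :: "'n \<Rightarrow> bool" where
  "autonomous i \<longleftrightarrow> (\<forall>k\<in>{1..p}. \<forall>j. j \<noteq> i \<longrightarrow> A k $ i $ j = 0)"

lemma autonomous_row_sum:
  assumes "autonomous i" "k \<in> {1..p}"
  shows "(\<Sum>j\<in>UNIV. A k $ i $ j * f j) = A k $ i $ i * f i"
proof -
  have "(\<Sum>j\<in>UNIV. A k $ i $ j * f j) = (\<Sum>j\<in>{i}. A k $ i $ j * f j)"
    by (rule sum.mono_neutral_right) (use assms in \<open>auto simp: autonomous_def\<close>)
  then show ?thesis by simp
qed

lemma autonomous_innovation: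
  assumes "autonomous i" "square_integrable M U"
  shows "covar M (lag_error (\<lambda>k. A k $ i $ i) p (Z i) t) U = covar M (E i t) U"
proof -
  have "(\<Sum>k=1..p. \<Sum>j\<in>UNIV. A k $ i $ j * covar M (Z j (t - int k)) U)
      = (\<Sum>k=1..p. A k $ i $ i * covar M (Z i (t - int k)) U)"
    by (rule sum.cong[OF refl autonomous_row_sum[OF assms(1)]])
  then show ?thesis
    using covar_recursion[OF assms(2), of i t]
    by (simp add: covar_lag_error_left square_integrable_Z assms(2))
qed

lemma autonomous_innovation_variance:
  assumes "autonomous i"
  shows "covar M (lag_error (\<lambda>k. A k $ i $ i) p (Z i) t) (lag_error (\<lambda>k. A k $ i $ i) p (Z i) t)
    = \<Sigma> $ i $ i"
  using assms
  by (simp add: autonomous_innovation square_integrable_lag_error square_integrable_Z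
      square_integrable_E covar_commute[of "E i t"] covar_E_E)

lemma covar_E_past_combination:
  "covar M (E i t) (\<lambda>w. \<Sum>k=1..n. c k * Z j (t - int k) w) = 0"
  by (simp add: covar_sum_right covar_cmult_right square_integrable_Z square_integrable_E
      square_integrable_cmult covar_E_past)

lemma restricted_residual_var_ge:
  assumes "AR_representation M c (Z i) xi"
  shows "\<Sigma> $ i $ i \<le> residual_var M xi"
proof (rule LIMSEQ_le_const)
  show "(\<lambda>n. covar M (lag_error c n (Z i) 0) (lag_error c n (Z i) 0)) \<longlonglongrightarrow> residual_var M xi"
    by (rule AR_residual_variance_limit[OF assms square_integrable_Z])
  show "\<exists>N. \<forall>n\<ge>N. \<Sigma> $ i $ i \<le> covar M (lag_error c n (Z i) 0) (lag_error c n (Z i) 0)"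
    unfolding lag_error_def
    by (intro exI allI impI innovation_variance_minimal covar_E_past_combination
        square_integrable_sum square_integrable_cmult square_integrable_Z)
qed

lemma residual_cov_symmetric: "\<Sigma> $ i $ j = \<Sigma> $ j $ i"
  using covar_commute[of "E i 0" "E j 0"] by (simp add: covar_E_E)

lemma residual_var_nonneg: "0 \<le> \<Sigma> $ i $ i"
  using covar_self_nonneg[of "E i 0"] by (simp add: covar_E_E)

end

section \<open>The innovations of the reversed process\<close>

locale reversible_VAR = bivariate_VAR M p A z e
  for M :: "'w measure" and p :: nat and A :: "nat \<Rightarrow> real^2^2"
    and z e :: "int \<Rightarrow> 'w \<Rightarrow> real^2" +
  fixes At :: "nat \<Rightarrow> real^2^2" and et :: "int \<Rightarrow> 'w \<Rightarrow> real^2"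
  assumes reversed: "reversed_VAR_representation M p At z et"

sublocale reversible_VAR \<subseteq> R: bivariate_VAR M p At "time_reverse z" "time_reverse et"
  using second_order_stationary_time_reverse[OF stationary] reversed
  by unfold_locales (simp_all add: reversed_VAR_representation_def)

context reversible_VAR
begin

abbreviation "\<Sigma>t \<equiv> residual_cov M et"

text \<open>The window \<open>z 0, \<dots>, z p\<close> can be built up from its first \<open>p\<close> members by adding the last one or
  from its last \<open>p\<close> members by adding the first one.\<close>

lemma det_residual_cov_time_reverse:
  assumes "diagonal_matrix \<Sigma>" "\<And>i. \<Sigma> $ i $ i > 0"
  shows "\<Sigma>t $ 1 $ 1 * \<Sigma>t $ 2 $ 2 - (\<Sigma>t $ 1 $ 2)\<^sup>2 = \<Sigma> $ 1 $ 1 * \<Sigma> $ 2 $ 2"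
proof -
  have "det (stacked_cov M z p) * (\<Sigma>t $ 1 $ 1 * \<Sigma>t $ 2 $ 2 - \<Sigma>t $ 1 $ 2 * \<Sigma>t $ 2 $ 1)
      = det (stacked_cov M z p) * (\<Sigma> $ 1 $ 1 * \<Sigma> $ 2 $ 2 - \<Sigma> $ 1 $ 2 * \<Sigma> $ 2 $ 1)"
    using R.det_stacked_cov_Suc det_stacked_cov_Suc
    by (simp add: det_stacked_cov_time_reverse residual_cov_time_reverse)
  then show ?thesis
    using det_stacked_cov_nonzero[OF assms] assms(1) R.residual_cov_symmetric[of 1 2]
    by (simp add: diagonal_matrix_def power2_eq_square residual_cov_time_reverse)
qed

lemma reversed_lag_error_variance:
  assumes "autonomous i"
  shows "covar M (lag_error (\<lambda>k. A k $ i $ i) p (time_reverse (Z i)) t)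
                 (lag_error (\<lambda>k. A k $ i $ i) p (time_reverse (Z i)) t) = \<Sigma> $ i $ i"
proof -
  have "covar M (lag_error (\<lambda>k. A k $ i $ i) p (time_reverse (Z i)) t)
                 (lag_error (\<lambda>k. A k $ i $ i) p (time_reverse (Z i)) t)
     = covar M (lag_error (\<lambda>k. A k $ i $ i) p (Z i) t) (lag_error (\<lambda>k. A k $ i $ i) p (Z i) t)"
    by (rule lag_error_variance_cong)
      (simp_all only: time_reverse_def covar_Z_reflect square_integrable_Z)
  then show ?thesis using autonomous_innovation_variance[OF assms] by simp
qed

text \<open>The forward coefficients of an autonomous component, applied to its future, give one
  admissible predictor in reversed time.\<close>

lemma reversed_innovation_variance_le:
  assumes "autonomous i"
  shows "\<Sigma>t $ i $ i \<le> \<Sigma> $ i $ i"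
proof -
  have "residual_cov M (time_reverse et) $ i $ i
      \<le> covar M (lag_error (\<lambda>k. A k $ i $ i) p (R.Z i) 0) (lag_error (\<lambda>k. A k $ i $ i) p (R.Z i) 0)"
    unfolding lag_error_def
    by (intro R.innovation_variance_minimal R.covar_E_past_combination
        square_integrable_sum square_integrable_cmult R.square_integrable_Z)
  then show ?thesis
    unfolding component_time_reverse residual_cov_time_reverse
    by (simp add: reversed_lag_error_variance[OF assms])
qed

lemma reversed_lag_error_eq_innovation:
  assumes "autonomous i" and opt: "\<Sigma>t $ i $ i = \<Sigma> $ i $ i" and V: "square_integrable M V"
  shows "covar M (lag_error (\<lambda>k. A k $ i $ i) p (time_reverse (Z i)) t) V = covar M (R.E i t) V"
proof -
  define U where "U = (\<lambda>w. \<Sum>k=1..p. A k $ i $ i * R.Z i (t - int k) w)"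
  have eq: "lag_error (\<lambda>k. A k $ i $ i) p (time_reverse (Z i)) t = (\<lambda>w. R.Z i t w - U w)"
    by (simp add: lag_error_def U_def component_time_reverse)
  have U: "square_integrable M U"
    unfolding U_def by (intro square_integrable_sum square_integrable_cmult R.square_integrable_Z)
  show ?thesis
    unfolding eq
  proof (rule R.optimal_prediction_error_unique[OF U _ _ V])
    show "covar M (R.E i t) U = 0"
      unfolding U_def by (rule R.covar_E_past_combination)
    show "covar M (\<lambda>w. R.Z i t w - U w) (\<lambda>w. R.Z i t w - U w) = residual_cov M (time_reverse et) $ i $ i"
      using reversed_lag_error_variance[OF assms(1), of t] opt
      unfolding eq residual_cov_time_reverse by simp
  qed
qed

text \<open>For \<open>s \<ge> t\<close> this goes by induction on \<open>s\<close>: an autonomous first component at time \<open>s\<close> is made of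
  its own past and its own noise, and the noise is uncorrelated with that of the second component.\<close>

lemma covar_E2_Z1:
  assumes aut: "autonomous 1" and diag: "diagonal_matrix \<Sigma>"
  shows "covar M (E 2 t) (Z 1 s) = 0"
proof (induction "nat (s - t)" arbitrary: s rule: less_induct)
  case less
  show ?case
  proof (cases "s < t")
    case True
    then show ?thesis by (rule covar_E_past)
  next
    case False
    have past: "covar M (Z 1 (s - int k)) (E 2 t) = 0" if "k \<in> {1..p}" for k
    proof (cases "s - int k < t")
      case True
      then show ?thesis by (simp add: covar_commute[of "Z _ _"] covar_E_past)
    next
      case nlt: False
      have "nat (s - int k - t) < nat (s - t)" using nlt that by auto
      then show ?thesis using less[of "s - int k"] by (simp add: covar_commute[of "Z _ _"])
    qed
    have "covar M (Z 1 s) (E 2 t) = covar M (E 1 s) (E 2 t)"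
      using autonomous_innovation[OF aut square_integrable_E, of s 2 t] past
      by (simp add: covar_lag_error_left square_integrable_Z square_integrable_E)
    also have "\<dots> = 0" using diag by (simp add: covar_E_E diagonal_matrix_def)
    finally show ?thesis by (simp add: covar_commute[of "E 2 t"])
  qed
qed

text \<open>Put \<open>a k = A k $ 1 $ 1\<close>, \<open>c k = A k $ 2 $ 1\<close> and \<open>d k = A k $ 2 $ 2\<close>. The reversed prediction error
  \<open>Q t = x t - (\<Sum>k. a k * x (t + k))\<close> of \<open>x\<close> is, by optimality, the first component of the reversed
  innovation, and therefore uncorrelated with \<open>y s\<close> for \<open>s \<ge> t\<close>, the case \<open>s = t\<close> being \<open>uncorr\<close>.
  The variable \<open>q = Q 0 - (\<Sum>k. a k * Q (- k))\<close> is dual to the process \<open>x\<close>: among all \<open>x s\<close> it is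
  correlated with \<open>x 0\<close> only. The covariance \<open>v t\<close> of \<open>y t\<close> with \<open>q\<close> therefore satisfies
  \<open>v t - (\<Sum>k. d k * v (t - k)) = c t * \<Sigma> $ 1 $ 1\<close>, where \<open>c t\<close> means \<open>0\<close> outside \<open>{1..p}\<close>.
  Now \<open>v\<close> vanishes at times \<open>t \<ge> 0\<close>. At times \<open>t \<le> 0\<close> it is a bounded solution of the homogeneous
  recurrence, and a nonzero one would grow exponentially towards the past. So \<open>v = 0\<close> and \<open>c = 0\<close>.\<close>

lemma coupling_vanishes:
  assumes aut: "autonomous 1" and diag: "diagonal_matrix \<Sigma>" and pos: "\<Sigma> $ 1 $ 1 > 0"
    and stable: "\<And>l::complex. norm l \<le> 1 \<Longrightarrow> 1 - (\<Sum>k=1..p. of_real (A k $ 2 $ 2) * l ^ k) \<noteq> 0"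
    and opt: "\<Sigma>t $ 1 $ 1 = \<Sigma> $ 1 $ 1" and uncorr: "\<Sigma>t $ 1 $ 2 = 0"
    and h: "h \<in> {1..p}"
  shows "A h $ 2 $ 1 = 0"
proof -
  let ?c = "\<lambda>k. A k $ 1 $ 1"
  define Q where "Q t = lag_error ?c p (time_reverse (Z 1)) (- t)" for t
  define q where "q = lag_error ?c p Q 0"
  have rev: "square_integrable M (time_reverse (Z 1) t)" for t
    by (simp add: time_reverse_def square_integrable_Z)
  have Q: "square_integrable M (Q t)" for t
    unfolding Q_def by (rule square_integrable_lag_error[OF rev])
  have q: "square_integrable M q"
    unfolding q_def by (rule square_integrable_lag_error[OF Q])
  have covar_Q: "covar M (Q t) V = covar M (R.E 1 (- t)) V" if "square_integrable M V" for t V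
    unfolding Q_def by (rule reversed_lag_error_eq_innovation[OF aut opt that])
  have QY: "covar M (Z 2 s) (Q t) = 0" if "t \<le> s" for s t
  proof -
    have "covar M (R.E 1 (- t)) (R.Z 2 (- s)) = 0"
      using that R.covar_E_past[of "- s" "- t" 1 2] R.covar_E_present[of 1 "- t" 2] uncorr
      by (cases "s = t") (auto simp: residual_cov_time_reverse)
    then show ?thesis
      using covar_Q[OF square_integrable_Z, of t 2 s]
      by (simp add: component_time_reverse time_reverse_def covar_commute[of "Z _ _"])
  qed
  have XQ_shift: "covar M (Z 1 s) (Q (- int k)) = covar M (Z 1 (s + int k)) (Q 0)" for s k
  proof -
    have "covar M (Z 1 (s + int k)) (Z 1 (int j)) = covar M (Z 1 s) (Z 1 (int j - int k))" for j
      using covar_shift[of 1 s "int k" 1 "int j - int k"] by simp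
    from this this[of 0] show ?thesis
      unfolding Q_def
      by (simp add: covar_lag_error_right rev square_integrable_Z)
        (simp add: time_reverse_def)
  qed
  have Xq: "covar M (Z 1 s) q = (if s = 0 then \<Sigma> $ 1 $ 1 else 0)" for s
  proof -
    have "covar M (Z 1 s) q
        = covar M (Z 1 s) (Q 0) - (\<Sum>k=1..p. ?c k * covar M (Z 1 (s + int k)) (Q 0))"
      unfolding q_def using XQ_shift
      by (simp add: covar_lag_error_right Q square_integrable_Z)
    also have "\<dots> = covar M (Q s) (Q 0)"
      unfolding Q_def[of s] by (simp add: covar_lag_error_left rev Q) (simp add: time_reverse_def add.commute)
    also have "\<dots> = covar M (R.E 1 (- s)) (R.E 1 0)"
      using covar_Q[OF Q, of s 0] covar_Q[OF R.square_integrable_E, of 0 1 "- s"]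
      by (simp add: covar_commute[of _ "Q 0"] covar_commute[of _ "R.E 1 0"])
    finally show ?thesis using opt by (simp add: R.covar_E_E residual_cov_time_reverse)
  qed
  have Eq: "covar M (E 2 t) q = 0" for t
  proof -
    have "covar M (E 2 t) (Q s) = 0" for s
      unfolding Q_def
      by (simp add: covar_lag_error_right rev square_integrable_E)
        (simp add: time_reverse_def covar_E2_Z1[OF aut diag])
    then show ?thesis
      unfolding q_def by (simp add: covar_lag_error_right Q square_integrable_E)
  qed
  define v where "v t = covar M (Z 2 t) q" for t
  have v_nonneg: "v t = 0" if "0 \<le> t" for t
    unfolding v_def q_def using that by (simp add: covar_lag_error_right Q square_integrable_Z QY)
  have v_rec: "v t = (\<Sum>k=1..p. A k $ 2 $ 1 * (if t = int k then \<Sigma> $ 1 $ 1 else 0))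
      + (\<Sum>k=1..p. A k $ 2 $ 2 * v (t - int k))" for t
    unfolding v_def using covar_recursion[OF q, of 2 t]
    by (simp add: sum_2 Xq Eq sum.distrib)
  have v_nonpos: "v (- int n) = 0" for n
  proof (rule bounded_solution_of_stable_recurrence[OF stable])
    show "\<bar>v (- int n)\<bar> \<le> sqrt (covar M (Z 2 0) (Z 2 0) * covar M q q)" for n
      using covar_Cauchy_Schwarz[OF square_integrable_Z q, of 2 "- int n"]
        covar_shift[of 2 0 "- int n" 2 0]
      unfolding v_def by (intro real_le_rsqrt) simp
    show "v (- int n) = (\<Sum>k=1..p. A k $ 2 $ 2 * v (- int (n + k)))" for n
    proof -
      have "(\<Sum>k=1..p. A k $ 2 $ 1 * (if - int n = int k then \<Sigma> $ 1 $ 1 else 0)) = 0"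
        by (rule sum.neutral) auto
      moreover have "- int (n + k) = - int n - int k" for k by simp
      ultimately show ?thesis using v_rec[of "- int n"] by simp
    qed
  qed
  have "v t = 0" for t
    using v_nonneg[of t] v_nonpos[of "nat (- t)"] by (cases "0 \<le> t") auto
  then have "0 = (\<Sum>k=1..p. A k $ 2 $ 1 * (if int h = int k then \<Sigma> $ 1 $ 1 else 0))"
    using v_rec[of "int h"] by simp
  also have "\<dots> = (\<Sum>k=1..p. if h = k then A k $ 2 $ 1 * \<Sigma> $ 1 $ 1 else 0)"
    by (rule sum.cong) auto
  also have "\<dots> = A h $ 2 $ 1 * \<Sigma> $ 1 $ 1" using h by simp
  finally show ?thesis using pos by simp
qed

end

section \<open>Net Granger scores of a triangular system\<close>

lemma stable_coeffs_lower_triangular: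
  fixes A :: "nat \<Rightarrow> real^2^2" and l :: complex
  assumes stable: "stable_coeffs p A" and tri: "\<forall>k\<in>{1..p}. lower_triangular_matrix (A k)"
    and l: "norm l \<le> 1"
  shows "1 - (\<Sum>k=1..p. of_real (A k $ 2 $ 2) * l ^ k) \<noteq> 0"
proof -
  have "(\<Sum>k=1..p. of_real (A k $ 1 $ 2) * l ^ k) = 0"
    using tri by (intro sum.neutral) (simp add: lower_triangular_matrix_def)
  then have "Determinants.det (Finite_Cartesian_Product.mat 1
        - (\<Sum>k=1..p. (\<chi> i j. complex_of_real (A k $ i $ j) * l ^ k)))
      = (1 - (\<Sum>k=1..p. of_real (A k $ 1 $ 1) * l ^ k))
        * (1 - (\<Sum>k=1..p. of_real (A k $ 2 $ 2) * l ^ k))"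
    by (simp add: det_2 Finite_Cartesian_Product.mat_def)
  then show ?thesis using stable l unfolding stable_coeffs_def by force
qed

theorem theorem2:
  fixes M :: "'w measure"
    and p :: nat
    and A At :: "nat \<Rightarrow> real^2^2"
    and z eps epst :: "int \<Rightarrow> 'w \<Rightarrow> real^2"
    and a b :: "nat \<Rightarrow> real"
    and x y xi_x xi_y xit_x xit_y :: "int \<Rightarrow> 'w \<Rightarrow> real"
    and S St :: "real^2^2"
    and Fyx Fxy Ftyx Ftxy Dnet :: real
  defines "x \<equiv> (\<lambda>t w. z t w $ 1)"
    and "y \<equiv> (\<lambda>t w. z t w $ 2)"
    and "S \<equiv> residual_cov M eps"
    and "St \<equiv> residual_cov M epst"
    and "Fyx \<equiv> granger_score (residual_var M xi_x) (S $ 1 $ 1)"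
    and "Fxy \<equiv> granger_score (residual_var M xi_y) (S $ 2 $ 2)"
    and "Ftyx \<equiv> granger_score (residual_var M xit_x) (St $ 1 $ 1)"
    and "Ftxy \<equiv> granger_score (residual_var M xit_y) (St $ 2 $ 2)"
    and "Dnet \<equiv> (Fxy - Fyx) - (Ftxy - Ftyx)"
  assumes "prob_space M"
    and "p \<ge> 1"
    and "stable_VAR_process M p A z eps"
    and "reversed_VAR_representation M p At z epst"
    and "AR_representation M a x xi_x"
    and "AR_representation M b y xi_y"
    and "reversed_AR_representation M a x xit_x"
    and "reversed_AR_representation M b y xit_y"
    and "S $ 1 $ 1 > 0" and "S $ 2 $ 2 > 0"
    and A1: "\<forall>k\<in>{1..p}. lower_triangular_matrix (A k)"
    and A2: "diagonal_matrix S"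
    and A3: "invertible (autocov M z 0)"
  shows "Dnet = 0 \<longleftrightarrow> (\<forall>k\<in>{1..p}. diagonal_matrix (A k))"
proof -
  note var = \<open>stable_VAR_process M p A z eps\<close>[unfolded stable_VAR_process_def]
    and S1 = \<open>S $ 1 $ 1 > 0\<close> and S2 = \<open>S $ 2 $ 2 > 0\<close>
  interpret prob_space M by fact
  interpret reversible_VAR M p A z eps At epst
    using var \<open>reversed_VAR_representation M p At z epst\<close> by unfold_locales auto
  have x: "x = Z 1" and y: "y = Z 2"
    by (simp_all add: x_def y_def component_def fun_eq_iff)
  note repx = \<open>AR_representation M a x xi_x\<close>[unfolded x]
    and repy = \<open>AR_representation M b y xi_y\<close>[unfolded y]
  have xit: "residual_var M xit_x = residual_var M xi_x"
    using AR_residual_var_time_reverse[OF repx _ square_integrable_Z covar_Z_reflect]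
      \<open>reversed_AR_representation M a x xit_x\<close> by (simp add: x)
  have yit: "residual_var M xit_y = residual_var M xi_y"
    using AR_residual_var_time_reverse[OF repy _ square_integrable_Z covar_Z_reflect]
      \<open>reversed_AR_representation M b y xit_y\<close> by (simp add: y)
  have pos: "\<Sigma> $ i $ i > 0" for i
    using S1 S2 exhaust_2[of i] by (auto simp: S_def)
  have xi: "residual_var M xi_x > 0" "residual_var M xi_y > 0"
    using restricted_residual_var_ge[OF repx] restricted_residual_var_ge[OF repy] S1 S2
    by (simp_all add: S_def)
  have aut: "autonomous 1"
    unfolding autonomous_def
  proof (intro ballI allI impI)
    fix k and j :: 2
    assume "k \<in> {1..p}" "j \<noteq> 1"
    then show "A k $ 1 $ j = 0"
      using A1 exhaust_2[of j] by (auto simp: lower_triangular_matrix_def)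
  qed
  have le: "St $ 1 $ 1 \<le> S $ 1 $ 1"
    using reversed_innovation_variance_le[OF aut] by (simp add: S_def St_def)
  have det: "St $ 1 $ 1 * St $ 2 $ 2 - (St $ 1 $ 2)\<^sup>2 = S $ 1 $ 1 * S $ 2 $ 2"
    using det_residual_cov_time_reverse[OF A2[unfolded S_def] pos] by (simp add: S_def St_def)
  have "0 < S $ 1 $ 1 * S $ 2 $ 2" using S1 S2 by simp
  then have prod: "0 < St $ 1 $ 1 * St $ 2 $ 2" and ge: "S $ 1 $ 1 * S $ 2 $ 2 \<le> St $ 1 $ 1 * St $ 2 $ 2"
    using det zero_le_power2[of "St $ 1 $ 2"] by linarith+
  have St: "St $ 1 $ 1 > 0" "St $ 2 $ 2 > 0"
    using prod R.residual_var_nonneg[of 1] R.residual_var_nonneg[of 2]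
    by (auto simp: zero_less_mult_iff St_def residual_cov_time_reverse)
  (* The restricted variances cancel, because they are the same in both directions of time. *)
  have "Dnet = ln (S $ 1 $ 1 * St $ 2 $ 2) - ln (S $ 2 $ 2 * St $ 1 $ 1)"
    using S1 S2 St xi
    by (simp add: Dnet_def Fxy_def Fyx_def Ftxy_def Ftyx_def granger_score_def xit yit ln_div ln_mult)
  then have D: "Dnet = 0 \<longleftrightarrow> S $ 1 $ 1 * St $ 2 $ 2 = S $ 2 $ 2 * St $ 1 $ 1"
    using S1 S2 St by simp
  show ?thesis
  proof
    assume "Dnet = 0"
    then have eq: "S $ 1 $ 1 * St $ 2 $ 2 = S $ 2 $ 2 * St $ 1 $ 1" using D by simp
    have opt: "St $ 1 $ 1 = S $ 1 $ 1"
    proof (rule ccontr)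
      assume "St $ 1 $ 1 \<noteq> S $ 1 $ 1"
      with le have lt: "St $ 1 $ 1 < S $ 1 $ 1" by simp
      then have "S $ 1 $ 1 * St $ 2 $ 2 < S $ 1 $ 1 * S $ 2 $ 2" using eq S2 by simp
      then have "St $ 2 $ 2 < S $ 2 $ 2" using S1 by simp
      with lt have "St $ 1 $ 1 * St $ 2 $ 2 < S $ 1 $ 1 * S $ 2 $ 2"
        using St by (intro mult_strict_mono) auto
      with ge show False by simp
    qed
    then have "St $ 2 $ 2 = S $ 2 $ 2" using eq S1 by simp
    then have uncorr: "St $ 1 $ 2 = 0" using det opt by simp
    show "\<forall>k\<in>{1..p}. diagonal_matrix (A k)"
    proof
      fix k assume k: "k \<in> {1..p}"
      have "A k $ 2 $ 1 = 0"
        using coupling_vanishes[OF aut A2[unfolded S_def] pos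
            stable_coeffs_lower_triangular[OF conjunct1[OF var] A1] _ _ k] opt uncorr
        by (simp add: S_def St_def)
      then show "diagonal_matrix (A k)"
        using A1 k by (simp add: diagonal_matrix_def lower_triangular_matrix_def)
    qed
  next
    assume "\<forall>k\<in>{1..p}. diagonal_matrix (A k)"
    then have diag: "A k $ 2 $ 1 = 0" if "k \<in> {1..p}" for k
      using that by (simp add: diagonal_matrix_def)
    have "autonomous 2"
      unfolding autonomous_def
    proof (intro ballI allI impI)
      fix k and j :: 2
      assume "k \<in> {1..p}" "j \<noteq> 2"
      then show "A k $ 2 $ j = 0"
        using diag exhaust_2[of j] by auto
    qed
    then have le2: "St $ 2 $ 2 \<le> S $ 2 $ 2"
      using reversed_innovation_variance_le by (simp add: S_def St_def)
    have "St $ 1 $ 1 = S $ 1 $ 1"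
    proof (rule ccontr)
      assume "St $ 1 $ 1 \<noteq> S $ 1 $ 1"
      with le have "St $ 1 $ 1 * St $ 2 $ 2 < S $ 1 $ 1 * St $ 2 $ 2" using St by simp
      also have "\<dots> \<le> S $ 1 $ 1 * S $ 2 $ 2" using le2 S1 by simp
      finally show False using ge by simp
    qed
    moreover from this have "St $ 2 $ 2 = S $ 2 $ 2" using ge le2 S1 by simp
    ultimately show "Dnet = 0" using D by simp
  qed
qed

end
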